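(* Let $S$ be an Arf numerical semigroup with multiplicity $5$ and conductor $s>5$. If $s\equiv 3\bmod 5$, then $S=\langle 5,s,s+1,s+3,s+4\rangle$, $\mathrm{PF}(S)=\{s-5,s-4,s-2,s-1\}$, and the row-factorization matrices are exactly the following $5\times5$ matrices, described by their rows $r_1,\dots,r_5$ in order (where alternatives for different rows are chosen independently). For $s-5$ (one matrix): $r_1=(-1,1,0,0,0)$, $r_2=(\frac{s-8}{5},-1,0,1,0)$, $r_3=(\frac{s-8}{5},0,-1,0,1)$, $r_4=(\frac{s-3}{5},0,1,-1,0)$, $r_5=(\frac{2s-1}{5},0,0,0,-1)$. For $s-4$ (two matrices): $r_1=(-1,0,1,0,0)$, $r_2=(\frac{s-8}{5},-1,0,0,1)$, $r_3=(\frac{s-3}{5},1,-1,0,0)$, $r_4=(\frac{2s-1}{5},0,0,-1,0)$, and $r_5=(\frac{s-3}{5},0,0,1,-1)$ or $r_5=(0,2,0,0,-1)$. For $s-2$ (four matrices): $r_1=(-1,0,0,1,0)$, $r_2=(\frac{s-3}{5},-1,1,0,0)$, $r_3=(\frac{2s-1}{5},0,-1,0,0)$, $r_4=(\frac{s-3}{5},0,0,-1,1)$ or $r_4=(0,1,1,-1,0)$, and $r_5=(\frac{s+2}{5},1,0,0,-1)$ or $r_5=(0,0,2,0,-1)$. For $s-1$ (eight matrices): $r_1=(-1,0,0,0,1)$, $r_2=(\frac{2s-1}{5},-1,0,0,0)$, $r_3=(\frac{s-3}{5},0,-1,1,0)$ or $r_3=(0,2,-1,0,0)$, $r_4=(\frac{s+2}{5},1,0,-1,0)$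 or $r_4=(0,0,2,-1,0)$, and $r_5=(\frac{s+2}{5},0,1,0,-1)$ or $r_5=(0,1,0,1,-1)$.
   Context: A numerical semigroup is a subset $S\subseteq\mathbb{N}_0$ (non-negative integers) containing $0$, closed under addition, with finite complement in $\mathbb{N}_0$; $\langle A\rangle$ is the set of $\mathbb{N}_0$-linear combinations of elements of $A$. The multiplicity is the smallest nonzero element of $S$; the conductor is one plus the greatest integer not in $S$. $S$ is Arf if $s_2+s_3-s_1\in S$ for all $s_1\le s_2\le s_3$ in $S$. $\mathrm{PF}(S)$ is the set of integers $z\notin S$ with $z+x\in S$ for all nonzero $x\in S$. If $n_1<\dots<n_e$ are the minimal generators of $S$, a row-factorization matrix of $f\in\mathrm{PF}(S)$ is an $e\times e$ integer matrix $[a_{ij}]$ with $a_{ii}=-1$, $a_{ij}\in\mathbb{N}_0$ for $i\ne j$, and $f=\sum_{j=1}^e a_{ij}n_j$ for each $i$. *)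

theory Defs
  imports "Jordan_Normal_Form.Matrix"
begin

definition numerical_semigroup :: "nat set \<Rightarrow> bool" where
  "numerical_semigroup S \<longleftrightarrow>
     0 \<in> S \<and> (\<forall>x\<in>S. \<forall>y\<in>S. x + y \<in> S) \<and> finite (- S)"

definition nat_span :: "nat set \<Rightarrow> nat set" where
  "nat_span A = {(\<Sum>x\<in>F. c x * x) | (F :: nat set) (c :: nat \<Rightarrow> nat). finite F \<and> F \<subseteq> A}"

definition semigroup_multiplicity :: "nat set \<Rightarrow> nat" where
  "semigroup_multiplicity S = (LEAST x. x \<in> S \<and> x \<noteq> 0)"

(* The greatest gap is taken among all integers, so that it is -1 for S = UNIV. *)
definition conductor :: "nat set \<Rightarrow> int" where
  "conductor S = (GREATEST z :: int. z \<notin> int ` S) + 1"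

(* The truncated subtraction on nat is exact here, as s1 \<le> s2. *)
definition Arf :: "nat set \<Rightarrow> bool" where
  "Arf S \<longleftrightarrow>
     (\<forall>s1\<in>S. \<forall>s2\<in>S. \<forall>s3\<in>S. s1 \<le> s2 \<longrightarrow> s2 \<le> s3 \<longrightarrow> s2 + s3 - s1 \<in> S)"

definition PF :: "nat set \<Rightarrow> int set" where
  "PF S = {z. z \<notin> int ` S \<and> (\<forall>x\<in>S. x \<noteq> 0 \<longrightarrow> z + int x \<in> int ` S)}"

definition minimal_generating_set :: "nat set \<Rightarrow> nat set \<Rightarrow> bool" where
  "minimal_generating_set A S \<longleftrightarrow> nat_span A = S \<and> (\<forall>B. B \<subset> A \<longrightarrow> nat_span B \<noteq> S)"

(* For numerical semigroups this is well defined by ex1_minimal_generating_set below. *)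
definition minimal_generators :: "nat set \<Rightarrow> nat set" where
  "minimal_generators S = (THE A. minimal_generating_set A S)"

(* Indices start at 0: n ! j is the (j+1)-st smallest minimal generator. *)
definition RF_matrices :: "nat set \<Rightarrow> int \<Rightarrow> int mat set" where
  "RF_matrices S f =
     (let n = sorted_list_of_set (minimal_generators S); e = length n in
      {A \<in> carrier_mat e e. f \<in> PF S \<and>
         (\<forall>i<e. A $$ (i, i) = -1 \<and>
                (\<forall>j<e. j \<noteq> i \<longrightarrow> A $$ (i, j) \<ge> 0) \<and>
                f = (\<Sum>j<e. A $$ (i, j) * int (n ! j)))})"

lemma nat_span_0: "0 \<in> nat_span A"
  unfolding nat_span_def by (auto intro!: exI[of _ "{}"])

lemma nat_span_base: "a \<in> A \<Longrightarrow> a \<in> nat_span A"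
  unfolding nat_span_def
  by (auto intro!: exI[of _ "{a}"] exI[of _ "\<lambda>_. 1"])

lemma nat_span_add:
  assumes "x \<in> nat_span A" "y \<in> nat_span A"
  shows "x + y \<in> nat_span A"
proof -
  obtain F c where F: "finite F" "F \<subseteq> A" "x = (\<Sum>a\<in>F. c a * a)"
    using assms(1) unfolding nat_span_def by auto
  obtain G d where G: "finite G" "G \<subseteq> A" "y = (\<Sum>a\<in>G. d a * a)"
    using assms(2) unfolding nat_span_def by auto
  let ?c = "\<lambda>a. if a \<in> F then c a else 0" and ?d = "\<lambda>a. if a \<in> G then d a else 0"
  have "x = (\<Sum>a\<in>F \<union> G. ?c a * a)" unfolding F(3)
    by (rule sum.mono_neutral_cong_left) (use F(1) G(1) in auto)
  moreover have "y = (\<Sum>a\<in>F \<union> G. ?d a * a)" unfolding G(3)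
    by (rule sum.mono_neutral_cong_left) (use F(1) G(1) in auto)
  ultimately have "x + y = (\<Sum>a\<in>F \<union> G. (?c a + ?d a) * a)"
    by (simp add: sum.distrib distrib_right)
  then show ?thesis unfolding nat_span_def using F(1,2) G(1,2)
    by (intro CollectI exI[of _ "F \<union> G"] exI[of _ "\<lambda>a. ?c a + ?d a"]) auto
qed

lemma irreducible_in_generating_set:
  assumes "nat_span A = S" "x \<in> S" "x \<noteq> 0"
    and irr: "\<And>a b. a \<in> S \<Longrightarrow> b \<in> S \<Longrightarrow> a \<noteq> 0 \<Longrightarrow> b \<noteq> 0 \<Longrightarrow> x \<noteq> a + b"
  shows "x \<in> A"
proof -
  obtain F c where F: "finite F" "F \<subseteq> A" "x = (\<Sum>a\<in>F. c a * a)"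
    using assms(1,2) unfolding nat_span_def by auto
  have "\<not> (\<forall>a\<in>F. c a * a = 0)"
    using F(3) \<open>x \<noteq> 0\<close> sum.neutral[of F "\<lambda>a. c a * a"] by metis
  then obtain y where y: "y \<in> F" "c y * y \<noteq> 0" by blast
  let ?r = "(c y - 1) * y + (\<Sum>a\<in>F - {y}. c a * a)"
  have "x = c y * y + (\<Sum>a\<in>F - {y}. c a * a)"
    unfolding F(3) using F(1) y(1) by (rule sum.remove)
  moreover have "c y * y = y + (c y - 1) * y"
    using y(2) by (cases "c y") auto
  ultimately have x: "x = y + ?r" by simp
  have "?r = (\<Sum>a\<in>F. (c(y := c y - 1)) a * a)"
    using F(1) y(1) by (simp add: sum.remove[of F y])
  then have rS: "?r \<in> S"
    using F(1,2) assms(1) unfolding nat_span_def by blast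
  have yS: "y \<in> S" using nat_span_base[of y A] y(1) F(2) assms(1) by auto
  have y0: "y \<noteq> 0" using y(2) by simp
  have "?r = 0"
  proof (rule ccontr)
    assume "?r \<noteq> 0"
    from irr[OF yS rS y0 this] x show False by (rule notE)
  qed
  then have "x = y" using x by linarith
  then show ?thesis using y(1) F(2) by auto
qed

lemma ex1_minimal_generating_set:
  assumes "numerical_semigroup S"
  shows "\<exists>!A. minimal_generating_set A S"
proof -
  define I where "I = {x \<in> S. x \<noteq> 0 \<and> (\<forall>a\<in>S. \<forall>b\<in>S. a \<noteq> 0 \<longrightarrow> b \<noteq> 0 \<longrightarrow> x \<noteq> a + b)}"
  have sub: "I \<subseteq> A" if "nat_span A = S" for A
    using irreducible_in_generating_set[OF that] unfolding I_def by blast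
  have "x \<in> S \<Longrightarrow> x \<in> nat_span I" for x
  proof (induction x rule: less_induct)
    case (less x)
    show ?case
    proof (cases "x = 0 \<or> x \<in> I")
      case True
      then show ?thesis using nat_span_0 nat_span_base by auto
    next
      case False
      then obtain a b where "a \<in> S" "b \<in> S" "a \<noteq> 0" "b \<noteq> 0" "x = a + b"
        using less.prems unfolding I_def by blast
      then show ?thesis using less.IH[of a] less.IH[of b] nat_span_add by simp
    qed
  qed
  moreover have "(\<Sum>x\<in>F. c x * x) \<in> S" if "finite F" "F \<subseteq> I" for F c
  proof -
    have mult: "k * x \<in> S" if "x \<in> S" for k x
      using assms that unfolding numerical_semigroup_def by (induction k) auto
    show ?thesis using that
    proof (induction F rule: finite_induct)
      case empty
      then show ?case using assms unfolding numerical_semigroup_def by simp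
    next
      case (insert x F)
      then show ?case using assms mult[of x "c x"]
        unfolding numerical_semigroup_def I_def by simp
    qed
  qed
  ultimately have I: "nat_span I = S" unfolding nat_span_def by blast
  show ?thesis
  proof (rule ex1I[of _ I])
    show "minimal_generating_set I S"
      unfolding minimal_generating_set_def using I sub by blast
    show "A = I" if "minimal_generating_set A S" for A
      using that I sub[of A] unfolding minimal_generating_set_def by blast
  qed
qed

end

theory Submission
  imports Defs
begin

text \<open>
  The Arf property forces every element of \<open>S\<close> below the conductor \<open>s\<close> to be a multiple of \<open>5\<close>.
  For \<open>x \<le> y\<close> in \<open>S\<close> it puts the reflection \<open>2 * y - x\<close> of \<open>x\<close> at \<open>y\<close> into \<open>S\<close>; an element
  that is not a multiple of \<open>5\<close>, played against a neighbouring multiple of \<open>5\<close>, would therefore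
  lead to an element smaller than \<open>s\<close> in the residue class \<open>2\<close>, and by adding fives to the gap
  \<open>s - 1\<close>. Hence \<open>S = {x. 5 dvd x \<or> s \<le> x}\<close> (\<open>Arf_multiplicity_5_eq\<close>), and the minimal generators
  and the pseudo-Frobenius numbers can be read off from this set.

  For the matrices, let \<open>n\<close> be the list of minimal generators. Moving the entry \<open>-1\<close> of the \<open>i\<close>-th
  row of a row-factorization matrix of \<open>f\<close> to the other side turns the row into a factorization of
  the semigroup element \<open>f + n ! i\<close> in which \<open>n ! i\<close> does not occur. That last condition holds for
  every factorization of \<open>f + n ! i\<close>, because otherwise \<open>f\<close> itself would lie in \<open>S\<close>. So the
  matrices correspond to the independent choices, one for each \<open>i\<close>, of a factorization of
  \<open>f + n ! i\<close> (\<open>RF_matrices_eq_listset\<close>), and their number is the product of the numbers of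
  factorizations.

  It remains to factorize thirteen elements, all at most \<open>2 * s + 3\<close>. A factorization of such an
  element uses at most two of the generators other than \<open>5\<close>, counted with multiplicity, and once these
  are chosen the coefficient of \<open>5\<close> is determined; this leaves the finite table \<open>factorization_table\<close>.
\<close>

section \<open>The shape of the semigroup\<close>

lemma conductor_props:
  assumes "numerical_semigroup S" and "conductor S = int s"
  shows "\<And>x. s \<le> x \<Longrightarrow> x \<in> S" and "0 < s \<Longrightarrow> s - 1 \<notin> S"
proof -
  \<comment> \<open>The entry \<open>-1\<close> is the greatest negative integer; it is the maximum exactly when \<open>S\<close> has no gaps.\<close>
  define M where "M = Max (insert (-1) (int ` (- S)))"
  have fin: "finite (insert (-1) (int ` (- S)))"
    using assms(1) unfolding numerical_semigroup_def by simp
  have upper: "z \<le> M" if "z \<notin> int ` S" for z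
  proof (cases "z < 0")
    case True
    then have "z \<le> -1" by simp
    also have "-1 \<le> M" unfolding M_def using fin by (intro Max_ge) auto
    finally show ?thesis .
  next
    case False
    then have "z = int (nat z)" by simp
    with that have "z \<in> int ` (- S)" by blast
    then show ?thesis unfolding M_def using fin by (intro Max_ge) auto
  qed
  have gap: "M \<notin> int ` S"
    using Max_in[OF fin] unfolding M_def[symmetric] by auto
  have "(GREATEST z :: int. z \<notin> int ` S) = M"
    using gap upper by (rule Greatest_equality)
  then have M: "M = int s - 1" using assms(2) unfolding conductor_def by simp
  show "x \<in> S" if "s \<le> x" for x
    using upper[of "int x"] that M by (auto simp: image_iff)
  show "s - 1 \<notin> S" if "0 < s"
    using gap M that by (auto simp: image_iff)
qed

lemma numerical_semigroup_mult:
  assumes "numerical_semigroup S" "x \<in> S"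
  shows "k * x \<in> S"
  using assms unfolding numerical_semigroup_def by (induction k) auto

lemma numerical_semigroup_sum:
  assumes "numerical_semigroup S" "\<And>x. x \<in> F \<Longrightarrow> g x \<in> S"
  shows "(\<Sum>x\<in>F. g x) \<in> S"
  using assms unfolding numerical_semigroup_def
  by (induction F rule: infinite_finite_induct) auto

lemma nat_span_subset:
  assumes "numerical_semigroup S" "A \<subseteq> S"
  shows "nat_span A \<subseteq> S"
  using assms unfolding nat_span_def
  by (auto intro!: numerical_semigroup_sum numerical_semigroup_mult)

text \<open>
  Since \<open>s - 1\<close> is a gap in the residue class \<open>2\<close> modulo \<open>5\<close>, no element of that class below \<open>s\<close>
  lies in \<open>S\<close>. Reflections at a multiple of \<open>5\<close>, or of one, carry each of the residue classes
  \<open>1\<close>, \<open>3\<close> and \<open>4\<close> to the class \<open>2\<close> while staying below \<open>s\<close>, so these classes are excluded too.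
\<close>

lemma Arf_multiplicity_5_eq:
  assumes S: "numerical_semigroup S" and "Arf S"
    and mult: "semigroup_multiplicity S = 5"
    and cond: "conductor S = int s" and "s > 5" and s3: "s mod 5 = 3"
  shows "S = {x. 5 dvd x \<or> s \<le> x}"
proof -
  have large: "x \<in> S" if "s \<le> x" for x
    using conductor_props(1)[OF S cond that] .
  have gap: "s - 1 \<notin> S" using conductor_props(2)[OF S cond] \<open>s > 5\<close> by simp
  have least: "(LEAST x. x \<in> S \<and> x \<noteq> 0) = 5"
    using mult unfolding semigroup_multiplicity_def .
  have "s \<in> S \<and> s \<noteq> 0" using large \<open>s > 5\<close> by simp
  from LeastI[of "\<lambda>x. x \<in> S \<and> x \<noteq> 0", OF this] have five: "5 \<in> S"
    unfolding least by simp
  have mult5: "5 * j \<in> S" for j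
    using numerical_semigroup_mult[OF S five, of j] by (simp add: mult.commute)
  have reflect: "2 * y - x \<in> S" if "x \<in> S" "y \<in> S" "x \<le> y" for x y
    using \<open>Arf S\<close> that unfolding Arf_def by (metis mult_2 order_refl)
  have no2: False if "5 * j + 2 \<in> S" "5 * j + 2 < s" for j
  proof -
    have "5 * j + 2 + 5 * (s div 5 - j) \<in> S"
      using S that(1) mult5 unfolding numerical_semigroup_def by blast
    moreover have "5 * j + 2 + 5 * (s div 5 - j) = s - 1" using that(2) s3 by presburger
    ultimately show False using gap by simp
  qed
  have "5 dvd x" if x: "x \<in> S" "x < s" for x
  proof (rule ccontr)
    assume ndvd: "\<not> 5 dvd x"
    define j where "j = x div 5"
    consider "x = 5 * j + 1" | "x = 5 * j + 2" | "x = 5 * j + 3" | "x = 5 * j + 4"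
      using ndvd unfolding j_def by atomize_elim presburger
    then show False
    proof cases
      case 1
      have "5 * j + 2 \<in> S" using reflect[OF mult5[of j] x(1)] 1 by simp
      moreover have "5 * j + 2 < s" using 1 x(2) s3 by presburger
      ultimately show False by (rule no2)
    next
      case 2
      then show False using no2 x by simp
    next
      case 3
      have "2 * (5 * (j + 1)) - x \<in> S"
        by (rule reflect[OF x(1) mult5]) (use 3 in simp)
      moreover have "2 * (5 * (j + 1)) - x = 5 * (j + 1) + 2" using 3 by simp
      ultimately have "5 * (j + 1) + 2 \<in> S" by (simp only:)
      moreover have "5 * (j + 1) + 2 < s" using 3 x(2) s3 by presburger
      ultimately show False by (rule no2)
    next
      case 4
      \<comment> \<open>One reflection only reaches the class \<open>1\<close>; a second one reaches the class \<open>2\<close>.\<close>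
      have "5 * j + 6 \<in> S" using reflect[OF x(1) mult5[of "j + 1"]] 4 by simp
      from reflect[OF mult5[of "j + 1"] this]
      have "5 * (j + 1) + 2 \<in> S" by simp
      moreover have "5 * (j + 1) + 2 < s" using 4 x(2) s3 by presburger
      ultimately show False by (rule no2)
    qed
  qed
  then show ?thesis using large mult5 by (force simp: dvd_def not_le)
qed

text \<open>
  A gap \<open>z\<close> with \<open>z + 5 \<in> S\<close> is either \<open>-5\<close> or one of the last five integers before \<open>s\<close>. Of these,
  \<open>s - 3\<close> is a multiple of \<open>5\<close>, and \<open>-5\<close> is excluded because \<open>s - 5\<close> is a gap.
\<close>

lemma PF_multiples_5_and_tail:
  assumes S: "S = {x. 5 dvd x \<or> s \<le> x}" and "s > 5" and "s mod 5 = 3"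
  shows "PF S = {int s - 5, int s - 4, int s - 2, int s - 1}"
proof -
  have mem: "z \<in> int ` S \<longleftrightarrow> 0 \<le> z \<and> (5 dvd z \<or> int s \<le> z)" for z
  proof -
    have "z \<in> int ` S \<longleftrightarrow> 0 \<le> z \<and> nat z \<in> S" by (auto simp: image_iff intro: bexI[of _ "nat z"])
    also have "\<dots> \<longleftrightarrow> 0 \<le> z \<and> (5 dvd z \<or> int s \<le> z)" unfolding S by auto presburger+
    finally show ?thesis .
  qed
  have s5: "int s mod 5 = 3" using \<open>s mod 5 = 3\<close> by presburger
  have "5 \<in> S" "s \<in> S" unfolding S by auto
  then have "z \<in> {int s - 5, int s - 4, int s - 2, int s - 1}" if "z \<in> PF S" for z
  proof -
    have "z \<notin> int ` S" "z + 5 \<in> int ` S" "z + int s \<in> int ` S"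
      using that \<open>5 \<in> S\<close> \<open>s \<in> S\<close> \<open>s > 5\<close> unfolding PF_def by force+
    then have gap: "\<not> (0 \<le> z \<and> (5 dvd z \<or> int s \<le> z))"
      and z5: "0 \<le> z + 5" "5 dvd z \<or> int s \<le> z + 5"
      and zs: "5 dvd z + int s \<or> 0 \<le> z"
      unfolding mem by auto
    have "0 \<le> z"
    proof (rule ccontr)
      assume "\<not> 0 \<le> z"
      then have "5 dvd z" "5 dvd z + int s" using z5 zs \<open>s > 5\<close> by auto
      then have "5 dvd int s" by (simp add: dvd_add_right_iff)
      then show False using s5 by presburger
    qed
    then have "\<not> 5 dvd z" "z < int s" "int s \<le> z + 5" using gap z5 by auto
    moreover from this have "z \<noteq> int s - 3" using s5 by presburger
    ultimately show ?thesis by auto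
  qed
  moreover have "z \<in> PF S" if z: "z \<in> {int s - 5, int s - 4, int s - 2, int s - 1}" for z
    unfolding PF_def mem
  proof (intro CollectI conjI ballI impI)
    show "\<not> (0 \<le> z \<and> (5 dvd z \<or> int s \<le> z))"
    proof -
      have "z mod 5 \<noteq> 0" using z s5 by (elim insertE emptyE) presburger+
      then show ?thesis using z by auto
    qed
    fix x assume x: "x \<in> S" "x \<noteq> 0"
    have "5 \<le> x" using x \<open>s > 5\<close> unfolding S by (auto dest: dvd_imp_le)
    then show "0 \<le> z + int x" "5 dvd z + int x \<or> int s \<le> z + int x"
      using z \<open>s > 5\<close> by auto
  qed
  ultimately show ?thesis by blast
qed

text \<open>
  The five generators are the least positive elements of their residue classes modulo \<open>5\<close>, so
  they generate \<open>S\<close>. A sum of two nonzero elements that equalled one of them would have a multiple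
  of \<open>5\<close> as a summand, since \<open>2 * s > s + 4\<close>, contradicting that minimality.
\<close>

lemma minimal_generators_multiples_5_and_tail:
  assumes ns: "numerical_semigroup S"
    and S: "S = {x. 5 dvd x \<or> s \<le> x}" and "s > 5" and "s mod 5 = 3"
  shows "nat_span {5, s, s + 1, s + 3, s + 4} = S"
    and "minimal_generators S = {5, s, s + 1, s + 3, s + 4}"
proof -
  let ?A = "{5, s, s + 1, s + 3, s + 4}"
  have mult5: "5 * m \<in> nat_span ?A" for m
  proof (induction m)
    case (Suc m)
    then show ?case using nat_span_add[OF nat_span_base[of 5 ?A]] by fastforce
  qed (simp add: nat_span_0)
  have "x \<in> nat_span ?A" if "x \<in> S" for x
  proof (cases "5 dvd x")
    case True
    then show ?thesis using mult5 by (auto simp: dvd_def)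
  next
    case False
    with that have "s \<le> x" unfolding S by simp
    define d where "d = x - s"
    have x: "x = s + d mod 5 + 5 * (d div 5)"
      using \<open>s \<le> x\<close> unfolding d_def by simp
    have "d mod 5 \<noteq> 2"
    proof
      assume "d mod 5 = 2"
      then have "x = s + 2 + 5 * (d div 5)" using x by simp
      moreover have "5 dvd s + 2" using \<open>s mod 5 = 3\<close> by presburger
      ultimately have "5 dvd x" by (simp only: dvd_add dvd_triv_left)
      with False show False by simp
    qed
    moreover have "d mod 5 < 5" by simp
    ultimately have "d mod 5 \<in> {0, 1, 3, 4}" unfolding insert_iff empty_iff by linarith
    then have "s + d mod 5 \<in> ?A" by auto
    then have "\<exists>g\<in>?A. \<exists>m. x = g + 5 * m" using x by blast
    then show ?thesis using nat_span_add[OF nat_span_base mult5] by blast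
  qed
  moreover have "nat_span ?A \<subseteq> S"
    using ns by (rule nat_span_subset) (auto simp: S)
  ultimately show span: "nat_span ?A = S" by blast
  have irr: "g \<in> B" if "nat_span B = S" "g \<in> ?A" for g B
  proof (rule irreducible_in_generating_set[OF that(1)])
    show "g \<in> S" "g \<noteq> 0" using that(2) \<open>s > 5\<close> by (auto simp: S)
    fix a b assume ab: "a \<in> S" "b \<in> S" "a \<noteq> 0" "b \<noteq> 0"
    have no_multiple: False if "g = c + d" "5 dvd c" "c \<noteq> 0" "d \<in> S" "d \<noteq> 0" for c d
    proof -
      have "5 \<le> c" using that(2,3) by (auto dest: dvd_imp_le)
      then have "d < s" "g \<noteq> 5" using that(1,5) \<open>g \<in> ?A\<close> \<open>s > 5\<close> by auto
      then have "5 dvd d" using that(4) unfolding S by simp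
      then have "5 dvd g" using that(1,2) by simp
      then have "g mod 5 = 0" by simp
      moreover have "(s + 1) mod 5 = 4" "(s + 3) mod 5 = 1" "(s + 4) mod 5 = 2"
        using \<open>s mod 5 = 3\<close> by presburger+
      ultimately show False using \<open>g \<in> ?A\<close> \<open>g \<noteq> 5\<close> \<open>s mod 5 = 3\<close> by auto
    qed
    show "g \<noteq> a + b"
    proof
      assume g: "g = a + b"
      then have "a < s \<or> b < s" using \<open>g \<in> ?A\<close> \<open>s > 5\<close> by auto
      then have "5 dvd a \<or> 5 dvd b" using ab(1,2) unfolding S by auto
      then show False
      proof
        assume "5 dvd a"
        then show False using no_multiple[of a b] g ab by simp
      next
        assume "5 dvd b"
        then show False using no_multiple[of b a] g ab by simp
      qed
    qed
  qed
  have "minimal_generating_set ?A S"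
    unfolding minimal_generating_set_def using span irr by blast
  then show "minimal_generators S = ?A"
    unfolding minimal_generators_def
    using ex1_minimal_generating_set[OF ns] by (rule the1_equality[rotated])
qed

section \<open>Row-factorization matrices from factorizations\<close>

definition factorizations :: "nat list \<Rightarrow> int \<Rightarrow> int list set" where
  "factorizations n t = {a. length a = length n \<and> (\<forall>j<length n. 0 \<le> a ! j)
     \<and> t = (\<Sum>j<length n. a ! j * int (n ! j))}"

lemma in_listset_iff:
  "xs \<in> listset As \<longleftrightarrow> length xs = length As \<and> (\<forall>i<length As. xs ! i \<in> As ! i)"
proof (induction As arbitrary: xs)
  case (Cons A As)
  then show ?case
    by (cases xs) (auto simp: set_Cons_def nth_Cons less_Suc_eq_0_disj split: nat.split)
qed auto

lemma card_listset: "card (listset As) = prod_list (map card As)"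
proof (induction As)
  case (Cons A As)
  have "set_Cons A (listset As) = (\<lambda>(x, xs). x # xs) ` (A \<times> listset As)"
    unfolding set_Cons_def by auto
  moreover have "inj_on (\<lambda>(x, xs). x # xs) (A \<times> listset As)"
    by (auto simp: inj_on_def)
  ultimately show ?case using Cons by (simp add: card_image card_cartesian_product)
qed simp

lemma inj_on_mat_of_rows_list:
  "inj_on (mat_of_rows_list m) {rs. length rs = e \<and> (\<forall>r\<in>set rs. length r = m)}"
proof (rule inj_onI)
  fix rs rs' :: "'a list list"
  assume rs: "rs \<in> {rs. length rs = e \<and> (\<forall>r\<in>set rs. length r = m)}"
    and rs': "rs' \<in> {rs. length rs = e \<and> (\<forall>r\<in>set rs. length r = m)}"
    and eq: "mat_of_rows_list m rs = mat_of_rows_list m rs'"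
  have "rs ! i ! j = rs' ! i ! j" if "i < e" "j < m" for i j
    using arg_cong[OF eq, of "\<lambda>A. A $$ (i, j)"] that rs rs'
    by (simp add: mat_of_rows_list_def)
  then show "rs = rs'" using rs rs' by (intro nth_equalityI) auto
qed

lemma factorization_in_semigroup:
  assumes "numerical_semigroup S" "set n \<subseteq> S" "a \<in> factorizations n t"
  shows "t \<in> int ` S"
proof -
  have "t = int (\<Sum>j<length n. nat (a ! j) * n ! j)"
    using assms(3) unfolding factorizations_def by simp
  moreover have "(\<Sum>j<length n. nat (a ! j) * n ! j) \<in> S"
    using assms(1,2) by (intro numerical_semigroup_sum numerical_semigroup_mult) auto
  ultimately show ?thesis by blast
qed

lemma sum_change_coefficient:
  fixes b :: int
  assumes "i < m" "length a = m"
  shows "(\<Sum>j<m. a[i := b] ! j * c j) = (\<Sum>j<m. a ! j * c j) + (b - a ! i) * c i"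
proof -
  have "(\<Sum>j<m. a[i := b] ! j * c j) = b * c i + (\<Sum>j\<in>{..<m} - {i}. a ! j * c j)"
    using assms by (subst sum.remove[of _ i]) (auto intro!: sum.cong)
  also have "\<dots> = (\<Sum>j<m. a ! j * c j) + (b - a ! i) * c i"
    using assms by (subst (2) sum.remove[of _ i]) (auto simp: algebra_simps)
  finally show ?thesis .
qed

text \<open>
  Adding \<open>n ! i\<close> to both sides of \<open>f = (\<Sum>j<length n. r ! j * int (n ! j))\<close> turns the entry \<open>-1\<close>
  into \<open>0\<close>. Conversely, a factorization of \<open>f + n ! i\<close> with positive \<open>i\<close>-th entry would, after lowering that entry by one,
  be a factorization of \<open>f\<close>, which is not in \<open>S\<close>.
\<close>

lemma row_iff_factorization:
  assumes S: "numerical_semigroup S" and n: "set n \<subseteq> S"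
    and f: "f \<notin> int ` S" and i: "i < length n"
  shows "(length r = length n \<and> r ! i = -1 \<and> (\<forall>j<length n. j \<noteq> i \<longrightarrow> 0 \<le> r ! j)
      \<and> f = (\<Sum>j<length n. r ! j * int (n ! j)))
    \<longleftrightarrow> r \<in> (\<lambda>a. a[i := -1]) ` factorizations n (f + int (n ! i))" (is "?L \<longleftrightarrow> ?R")
proof
  assume L: ?L
  then have "(\<Sum>j<length n. r[i := 0] ! j * int (n ! j)) = f + int (n ! i)"
    using i by (subst sum_change_coefficient) auto
  then have "r[i := 0] \<in> factorizations n (f + int (n ! i))"
    using L i unfolding factorizations_def by (auto simp: nth_list_update)
  moreover have "r = (r[i := 0])[i := -1]"
    using L by (metis list_update_id list_update_overwrite)
  ultimately show ?R by blast
next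
  assume ?R
  then obtain a where a: "a \<in> factorizations n (f + int (n ! i))" and r: "r = a[i := -1]"
    by blast
  have len: "length a = length n" and nn: "\<And>j. j < length n \<Longrightarrow> 0 \<le> a ! j"
    and sum: "f + int (n ! i) = (\<Sum>j<length n. a ! j * int (n ! j))"
    using a unfolding factorizations_def by auto
  have "a ! i = 0"
  proof (rule ccontr)
    assume "a ! i \<noteq> 0"
    then have "0 \<le> a ! i - 1" using nn[OF i] by simp
    moreover have "(\<Sum>j<length n. a[i := a ! i - 1] ! j * int (n ! j)) = f"
      using i len sum by (subst sum_change_coefficient) (auto simp: algebra_simps)
    ultimately have "a[i := a ! i - 1] \<in> factorizations n f"
      using i len nn unfolding factorizations_def by (auto simp: nth_list_update)
    then show False using factorization_in_semigroup[OF S n] f by blast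
  qed
  then have "(\<Sum>j<length n. r ! j * int (n ! j)) = f"
    using i len sum unfolding r by (subst sum_change_coefficient) auto
  then show ?L using i len nn unfolding r by auto
qed

text \<open>
  The defining conditions of a row-factorization matrix concern each row separately, so the set of
  matrices is a product of sets of rows, and its cardinality is the product of their cardinalities.
\<close>

lemma RF_matrices_eq_listset:
  assumes S: "numerical_semigroup S" and f: "f \<in> PF S"
    and n: "n = sorted_list_of_set (minimal_generators S)" "set n \<subseteq> S"
  defines "R \<equiv> map (\<lambda>i. (\<lambda>a. a[i := -1]) ` factorizations n (f + int (n ! i))) [0..<length n]"
  shows "RF_matrices S f = mat_of_rows_list (length n) ` listset R"
    and "card (RF_matrices S f) = prod_list (map card R)"
proof -
  let ?e = "length n"
  have fS: "f \<notin> int ` S" using f unfolding PF_def by blast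
  have R: "rs \<in> listset R \<longleftrightarrow> length rs = ?e \<and>
      (\<forall>i<?e. length (rs ! i) = ?e \<and> rs ! i ! i = -1 \<and> (\<forall>j<?e. j \<noteq> i \<longrightarrow> 0 \<le> rs ! i ! j)
        \<and> f = (\<Sum>j<?e. rs ! i ! j * int (n ! j)))" for rs
    unfolding in_listset_iff R_def
    by (simp add: row_iff_factorization[OF S n(2) fS, symmetric] cong: conj_cong)
  show eq: "RF_matrices S f = mat_of_rows_list ?e ` listset R"
  proof (intro equalityI subsetI)
    fix A assume "A \<in> RF_matrices S f"
    then have A: "A \<in> carrier_mat ?e ?e"
      and rows: "\<And>i. i < ?e \<Longrightarrow> A $$ (i, i) = -1 \<and> (\<forall>j<?e. j \<noteq> i \<longrightarrow> A $$ (i, j) \<ge> 0) \<and>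
                f = (\<Sum>j<?e. A $$ (i, j) * int (n ! j))"
      unfolding RF_matrices_def Let_def n(1)[symmetric] by auto
    let ?rs = "map (\<lambda>i. map (\<lambda>j. A $$ (i, j)) [0..<?e]) [0..<?e]"
    have "A = mat_of_rows_list ?e ?rs"
      using A by (intro eq_matI) (auto simp: mat_of_rows_list_def)
    moreover have "?rs \<in> listset R" unfolding R using rows by simp
    ultimately show "A \<in> mat_of_rows_list ?e ` listset R" by blast
  next
    fix A assume "A \<in> mat_of_rows_list ?e ` listset R"
    then obtain rs where A: "A = mat_of_rows_list ?e rs" and "rs \<in> listset R" by blast
    then show "A \<in> RF_matrices S f"
      using f unfolding R RF_matrices_def Let_def n(1)[symmetric]
      by (auto simp: mat_of_rows_list_def)
  qed
  have "inj_on (mat_of_rows_list ?e) (listset R)"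
    using inj_on_mat_of_rows_list by (rule inj_on_subset) (auto simp: R in_set_conv_nth)
  then show "card (RF_matrices S f) = prod_list (map card R)"
    unfolding eq by (simp add: card_image card_listset)
qed

section \<open>Factorizations of the elements that occur\<close>

lemma in_factorizations_5:
  "a \<in> factorizations [n0, n1, n2, n3, n4] t \<longleftrightarrow>
    (\<exists>a0 a1 a2 a3 a4. a = [a0, a1, a2, a3, a4] \<and> 0 \<le> a0 \<and> 0 \<le> a1 \<and> 0 \<le> a2 \<and> 0 \<le> a3 \<and> 0 \<le> a4
      \<and> t = a0 * int n0 + a1 * int n1 + a2 * int n2 + a3 * int n3 + a4 * int n4)"
proof -
  have "a \<in> factorizations [n0, n1, n2, n3, n4] t \<longleftrightarrow> length a = 5 \<and> (\<forall>j<5. 0 \<le> a ! j)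
     \<and> t = (\<Sum>j<5. a ! j * int ([n0, n1, n2, n3, n4] ! j))"
    unfolding factorizations_def by (simp add: eval_nat_numeral)
  also have "\<dots> \<longleftrightarrow> (\<exists>a0 a1 a2 a3 a4. a = [a0, a1, a2, a3, a4] \<and> 0 \<le> a0 \<and> 0 \<le> a1 \<and> 0 \<le> a2 \<and> 0 \<le> a3 \<and> 0 \<le> a4
      \<and> t = a0 * int n0 + a1 * int n1 + a2 * int n2 + a3 * int n3 + a4 * int n4)"
    by (auto simp: eval_nat_numeral length_Suc_conv All_less_Suc)
  finally show ?thesis .
qed

text \<open>
  Three of the generators \<open>s, s + 1, s + 3, s + 4\<close> already sum to at least \<open>3 * s > 2 * s + 3\<close>, and
  a sum of two of them is admissible only if its excess over \<open>2 * s\<close> is at most \<open>3\<close>.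
\<close>

lemma few_large_generators:
  fixes s :: int
  assumes "0 \<le> a0" "0 \<le> a1" "0 \<le> a2" "0 \<le> a3" "0 \<le> a4"
    and "3 < s"
    and "a0 * 5 + a1 * s + a2 * (s + 1) + a3 * (s + 3) + a4 * (s + 4) \<le> 2 * s + 3"
  shows "(a1, a2, a3, a4) \<in>
    {(0,0,0,0), (1,0,0,0), (0,1,0,0), (0,0,1,0), (0,0,0,1),
     (2,0,0,0), (1,1,0,0), (0,2,0,0), (1,0,1,0)}"
proof -
  have le: "(a1 + a2 + a3 + a4) * s + (a2 + 3 * a3 + 4 * a4) \<le> 2 * s + 3"
    using assms by (simp add: algebra_simps)
  then have "(a1 + a2 + a3 + a4) * s < 3 * s" using assms by linarith
  then have lt: "a1 + a2 + a3 + a4 < 3" using \<open>3 < s\<close> by simp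
  consider "a1 + a2 + a3 + a4 \<le> 1" | "a1 + a2 + a3 + a4 = 2" using lt by linarith
  then show ?thesis
  proof cases
    case 1
    then have "a1 = 0 \<or> a1 = 1" "a2 = 0 \<or> a2 = 1" "a3 = 0 \<or> a3 = 1" "a4 = 0 \<or> a4 = 1"
      using assms(2-5) by linarith+
    then show ?thesis using 1 by (elim disjE) simp_all
  next
    case 2
    then have small: "a2 + 3 * a3 + 4 * a4 \<le> 3" using le by simp
    have "a4 = 0" using small assms(3-5) by linarith
    have "a3 = 0 \<or> a3 = 1" using small assms(3-5) by linarith
    then show ?thesis
    proof
      assume "a3 = 0"
      then have "a1 = 2 - a2" using 2 \<open>a4 = 0\<close> by simp
      moreover have "a2 = 0 \<or> a2 = 1 \<or> a2 = 2"
        using calculation assms(2,3) by linarith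
      ultimately show ?thesis using \<open>a3 = 0\<close> \<open>a4 = 0\<close> by (elim disjE) simp_all
    next
      assume "a3 = 1"
      then have "a2 = 0" using small \<open>a4 = 0\<close> assms(3) by simp
      then show ?thesis using 2 \<open>a3 = 1\<close> \<open>a4 = 0\<close> by simp
    qed
  qed
qed

text \<open>
  These are the values that \<open>f + n ! i\<close> takes for the four pseudo-Frobenius numbers \<open>f\<close>. Modulo \<open>5\<close>
  the generators are \<open>0, 3, 4, 1, 2\<close>, and each admissible choice of generators other than \<open>5\<close>
  contributes exactly if it has the residue of the element and does not exceed it.
\<close>

lemma factorization_table:
  assumes k: "1 \<le> k" and s: "int s = 5 * k + 3"
  defines "Z \<equiv> factorizations [5, s, s + 1, s + 3, s + 4]"
  shows "Z (int s) = {[0, 1, 0, 0, 0]}"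
    and "Z (int s + 1) = {[0, 0, 1, 0, 0]}"
    and "Z (int s + 3) = {[0, 0, 0, 1, 0]}"
    and "Z (int s + 4) = {[0, 0, 0, 0, 1]}"
    and "Z (2 * int s - 5) = {[k - 1, 0, 0, 1, 0]}"
    and "Z (2 * int s - 4) = {[k - 1, 0, 0, 0, 1]}"
    and "Z (2 * int s - 3) = {[k, 1, 0, 0, 0]}"
    and "Z (2 * int s - 2) = {[k, 0, 1, 0, 0]}"
    and "Z (2 * int s - 1) = {[2 * k + 1, 0, 0, 0, 0]}"
    and "Z (2 * int s) = {[k, 0, 0, 1, 0], [0, 2, 0, 0, 0]}"
    and "Z (2 * int s + 1) = {[k, 0, 0, 0, 1], [0, 1, 1, 0, 0]}"
    and "Z (2 * int s + 2) = {[k + 1, 1, 0, 0, 0], [0, 0, 2, 0, 0]}"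
    and "Z (2 * int s + 3) = {[k + 1, 0, 1, 0, 0], [0, 1, 0, 1, 0]}"
proof -
  \<comment> \<open>The admissible coefficients of \<open>s, s + 1, s + 3, s + 4\<close>.\<close>
  define V :: "(int \<times> int \<times> int \<times> int) set" where "V =
    {(0,0,0,0), (1,0,0,0), (0,1,0,0), (0,0,1,0), (0,0,0,1),
     (2,0,0,0), (1,1,0,0), (0,2,0,0), (1,0,1,0)}"
  \<comment> \<open>If the other generators contribute \<open>u\<close>, then the coefficient of \<open>5\<close> can only be
    \<open>(t - u) div 5\<close>: in \<open>P t u a\<close> the list \<open>a\<close> of the other coefficients is completed by it.\<close>
  define P where "P t u a = (if u \<le> t \<and> 5 dvd t - u then {(t - u) div 5 # a} else {})"
    for t u :: int and a
  have P: "b # a \<in> P t u c \<longleftrightarrow> 0 \<le> b \<and> a = c \<and> t = b * 5 + u" for t u a b c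
    unfolding P_def by (auto simp: dvd_def)
  have Z: "Z t = (\<Union>(a1, a2, a3, a4)\<in>V.
      P t (a1 * int s + a2 * (int s + 1) + a3 * (int s + 3) + a4 * (int s + 4)) [a1, a2, a3, a4])"
    (is "_ = ?U") if t: "t \<le> 2 * int s + 3" for t
  proof (intro equalityI subsetI)
    fix a assume "a \<in> Z t"
    then obtain a0 a1 a2 a3 a4 where a: "a = [a0, a1, a2, a3, a4]"
      and nn: "0 \<le> a0" "0 \<le> a1" "0 \<le> a2" "0 \<le> a3" "0 \<le> a4"
      and sum: "t = a0 * 5 + a1 * int s + a2 * (int s + 1) + a3 * (int s + 3) + a4 * (int s + 4)"
      unfolding Z_def in_factorizations_5 by (auto simp: ac_simps)
    have "(a1, a2, a3, a4) \<in> V" unfolding V_def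
      by (rule few_large_generators[OF nn, where s = "int s"]) (use k s t sum in auto)
    moreover have "a \<in> P t (a1 * int s + a2 * (int s + 1) + a3 * (int s + 3) + a4 * (int s + 4)) [a1, a2, a3, a4]"
      unfolding a P using nn(1) sum by simp
    ultimately show "a \<in> ?U" by blast
  next
    fix a assume "a \<in> ?U"
    then obtain a1 a2 a3 a4 where V: "(a1, a2, a3, a4) \<in> V"
      and a: "a \<in> P t (a1 * int s + a2 * (int s + 1) + a3 * (int s + 3) + a4 * (int s + 4)) [a1, a2, a3, a4]"
      by blast
    then obtain b c where "a = b # c" unfolding P_def by (auto split: if_splits)
    then show "a \<in> Z t" using a V unfolding Z_def in_factorizations_5
      by (auto simp: P V_def ac_simps)
  qed
  have dvd5: "5 dvd 5 * k + c \<longleftrightarrow> 5 dvd c" "5 dvd c + 5 * k \<longleftrightarrow> 5 dvd c"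
    "5 dvd 10 * k + c \<longleftrightarrow> 5 dvd c" "5 dvd c + 10 * k \<longleftrightarrow> 5 dvd c"
    "5 dvd 5 * k - c \<longleftrightarrow> 5 dvd c" "5 dvd c - 5 * k \<longleftrightarrow> 5 dvd c" for c
    by presburger+
  show "Z (int s) = {[0, 1, 0, 0, 0]}"
    and "Z (int s + 1) = {[0, 0, 1, 0, 0]}"
    and "Z (int s + 3) = {[0, 0, 0, 1, 0]}"
    and "Z (int s + 4) = {[0, 0, 0, 0, 1]}"
    and "Z (2 * int s - 5) = {[k - 1, 0, 0, 1, 0]}"
    and "Z (2 * int s - 4) = {[k - 1, 0, 0, 0, 1]}"
    and "Z (2 * int s - 3) = {[k, 1, 0, 0, 0]}"
    and "Z (2 * int s - 2) = {[k, 0, 1, 0, 0]}"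
    and "Z (2 * int s - 1) = {[2 * k + 1, 0, 0, 0, 0]}"
    and "Z (2 * int s) = {[k, 0, 0, 1, 0], [0, 2, 0, 0, 0]}"
    and "Z (2 * int s + 1) = {[k, 0, 0, 0, 1], [0, 1, 1, 0, 0]}"
    and "Z (2 * int s + 2) = {[k + 1, 1, 0, 0, 0], [0, 0, 2, 0, 0]}"
    and "Z (2 * int s + 3) = {[k + 1, 0, 1, 0, 0], [0, 1, 0, 1, 0]}"
    using k by (simp_all add: Z V_def P_def s dvd5 insert_commute add.commute)
qed

theorem proposition3p9:
  fixes S :: "nat set" and s :: nat
  assumes "numerical_semigroup S" and "Arf S"
    and "semigroup_multiplicity S = 5"
    and "conductor S = int s" and "s > 5"
    and "s mod 5 = 3"
  shows "S = nat_span {5, s, s + 1, s + 3, s + 4}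
    \<and> PF S = {int s - 5, int s - 4, int s - 2, int s - 1}
    \<and> RF_matrices S (int s - 5) =
        {mat_of_rows_list 5
          [[-1, 1, 0, 0, 0],
           [(int s - 8) div 5, -1, 0, 1, 0],
           [(int s - 8) div 5, 0, -1, 0, 1],
           [(int s - 3) div 5, 0, 1, -1, 0],
           [(2 * int s - 1) div 5, 0, 0, 0, -1]]}
    \<and> card (RF_matrices S (int s - 5)) = 1
    \<and> RF_matrices S (int s - 4) =
        {mat_of_rows_list 5
          [[-1, 0, 1, 0, 0],
           [(int s - 8) div 5, -1, 0, 0, 1],
           [(int s - 3) div 5, 1, -1, 0, 0],
           [(2 * int s - 1) div 5, 0, 0, -1, 0],
           r5]
         | r5. r5 \<in> {[(int s - 3) div 5, 0, 0, 1, -1], [0, 2, 0, 0, -1]}}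
    \<and> card (RF_matrices S (int s - 4)) = 2
    \<and> RF_matrices S (int s - 2) =
        {mat_of_rows_list 5
          [[-1, 0, 0, 1, 0],
           [(int s - 3) div 5, -1, 1, 0, 0],
           [(2 * int s - 1) div 5, 0, -1, 0, 0],
           r4,
           r5]
         | r4 r5. r4 \<in> {[(int s - 3) div 5, 0, 0, -1, 1], [0, 1, 1, -1, 0]}
                \<and> r5 \<in> {[(int s + 2) div 5, 1, 0, 0, -1], [0, 0, 2, 0, -1]}}
    \<and> card (RF_matrices S (int s - 2)) = 4
    \<and> RF_matrices S (int s - 1) =
        {mat_of_rows_list 5
          [[-1, 0, 0, 0, 1],
           [(2 * int s - 1) div 5, -1, 0, 0, 0],
           r3,
           r4,
           r5]
         | r3 r4 r5. r3 \<in> {[(int s - 3) div 5, 0, -1, 1, 0], [0, 2, -1, 0, 0]}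
                   \<and> r4 \<in> {[(int s + 2) div 5, 1, 0, -1, 0], [0, 0, 2, -1, 0]}
                   \<and> r5 \<in> {[(int s + 2) div 5, 0, 1, 0, -1], [0, 1, 0, 1, -1]}}
    \<and> card (RF_matrices S (int s - 1)) = 8"
proof -
  define k where "k = int s div 5"
  have k: "1 \<le> k" and s: "int s = 5 * k + 3"
    using assms(5,6) unfolding k_def by presburger+
  have S: "S = {x. 5 dvd x \<or> s \<le> x}" using assms by (rule Arf_multiplicity_5_eq)
  note gens = minimal_generators_multiples_5_and_tail[OF assms(1) S assms(5,6)]
  note PF = PF_multiples_5_and_tail[OF S assms(5,6)]
  let ?n = "[5, s, s + 1, s + 3, s + 4]"
  have "sorted_list_of_set (set ?n) = ?n"
    using \<open>s > 5\<close> by (intro sorted_list_of_set.idem_if_sorted_distinct) auto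
  then have n: "?n = sorted_list_of_set (minimal_generators S)" using gens(2) by simp
  have nS: "set ?n \<subseteq> S" unfolding S by auto
  define F where "F = factorizations ?n"
  note RF = RF_matrices_eq_listset[OF assms(1) _ n nS, folded F_def]
  have div: "(int s - 8) div 5 = k - 1" "(int s - 3) div 5 = k"
    "(int s + 2) div 5 = k + 1" "(2 * int s - 1) div 5 = 2 * k + 1"
    using s by presburger+
  have rows: "[0..<5] = [0, 1, 2, 3, 4 :: nat]" by (simp add: upt_rec)
  note table = factorization_table[OF k s, folded F_def]
  (* The commuted copies match the form into which simplification brings f + n ! i. *)
  note Z = table table(2-4,11-13)[unfolded add.commute[of "int s"] add.commute[of "2 * int s"]]
  have len: "length ?n = 5" by simp
  have f: "int s - 5 \<in> PF S" "int s - 4 \<in> PF S" "int s - 2 \<in> PF S" "int s - 1 \<in> PF S"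
    unfolding PF by auto
  have "RF_matrices S (int s - 5) =
        {mat_of_rows_list 5
          [[-1, 1, 0, 0, 0],
           [(int s - 8) div 5, -1, 0, 1, 0],
           [(int s - 8) div 5, 0, -1, 0, 1],
           [(int s - 3) div 5, 0, 1, -1, 0],
           [(2 * int s - 1) div 5, 0, 0, 0, -1]]}"
    unfolding RF(1)[OF f(1)] len rows div
    by (auto simp: Z set_Cons_def)
  moreover have "card (RF_matrices S (int s - 5)) = 1"
    unfolding RF(2)[OF f(1)] len rows
    by (simp add: Z)
  moreover have "RF_matrices S (int s - 4) =
        {mat_of_rows_list 5
          [[-1, 0, 1, 0, 0],
           [(int s - 8) div 5, -1, 0, 0, 1],
           [(int s - 3) div 5, 1, -1, 0, 0],
           [(2 * int s - 1) div 5, 0, 0, -1, 0],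
           r5]
         | r5. r5 \<in> {[(int s - 3) div 5, 0, 0, 1, -1], [0, 2, 0, 0, -1]}}"
    unfolding RF(1)[OF f(2)] len rows div
    by (auto simp: Z set_Cons_def)
  moreover have "card (RF_matrices S (int s - 4)) = 2"
    unfolding RF(2)[OF f(2)] len rows
    by (simp add: Z)
  moreover have "RF_matrices S (int s - 2) =
        {mat_of_rows_list 5
          [[-1, 0, 0, 1, 0],
           [(int s - 3) div 5, -1, 1, 0, 0],
           [(2 * int s - 1) div 5, 0, -1, 0, 0],
           r4,
           r5]
         | r4 r5. r4 \<in> {[(int s - 3) div 5, 0, 0, -1, 1], [0, 1, 1, -1, 0]}
                \<and> r5 \<in> {[(int s + 2) div 5, 1, 0, 0, -1], [0, 0, 2, 0, -1]}}"
    unfolding RF(1)[OF f(3)] len rows div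
    by (auto simp: Z set_Cons_def)
  moreover have "card (RF_matrices S (int s - 2)) = 4"
    unfolding RF(2)[OF f(3)] len rows
    by (simp add: Z)
  moreover have "RF_matrices S (int s - 1) =
        {mat_of_rows_list 5
          [[-1, 0, 0, 0, 1],
           [(2 * int s - 1) div 5, -1, 0, 0, 0],
           r3,
           r4,
           r5]
         | r3 r4 r5. r3 \<in> {[(int s - 3) div 5, 0, -1, 1, 0], [0, 2, -1, 0, 0]}
                   \<and> r4 \<in> {[(int s + 2) div 5, 1, 0, -1, 0], [0, 0, 2, -1, 0]}
                   \<and> r5 \<in> {[(int s + 2) div 5, 0, 1, 0, -1], [0, 1, 0, 1, -1]}}"
    unfolding RF(1)[OF f(4)] len rows div
    by (auto simp: Z set_Cons_def)
  moreover have "card (RF_matrices S (int s - 1)) = 8"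
    unfolding RF(2)[OF f(4)] len rows
    by (simp add: Z)
  ultimately show ?thesis using gens(1)[symmetric] PF by (intro conjI)
qed

end
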